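(* Let $\mathbb{J}$ be a small category. If colimits of shape $\mathbb{J}$ commute with equalizers in $\mathbf{Set}$, then $\mathbb{J}$ is pseudo-filtered.
   Context: For small categories $\mathbb{I}$ and $\mathbb{J}$, limits of shape $\mathbb{I}$ commute with colimits of shape $\mathbb{J}$ in $\mathbf{Set}$ if, for every functor $F:\mathbb{I}\times\mathbb{J}\to\mathbf{Set}$, the canonical map $\operatorname{colim}_{j\in\mathbb{J}}\lim_{i\in\mathbb{I}}F(i,j)\to\lim_{i\in\mathbb{I}}\operatorname{colim}_{j\in\mathbb{J}}F(i,j)$ is a bijection. Colimits of shape $\mathbb{J}$ commute with equalizers if this holds when $\mathbb{I}=(\bullet\rightrightarrows\bullet)$ is the category with two objects and exactly two non-identity morphisms, which are parallel. A category is pseudo-filtered if each of its connected components is a filtered category (the empty category, having no connected components, is pseudo-filtered). *)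

theory Defs
  imports Main "HOL-Library.FuncSet"
begin

section \<open>Categories\<close>

text \<open>Objects and arrows form sets, so categories are small; composition is in applicative order
  and only meaningful on composable pairs of arrows.\<close>

record ('o, 'a) cat =
  Obj :: "'o set"
  Arr :: "'a set"
  Dom :: "'a \<Rightarrow> 'o"
  Cod :: "'a \<Rightarrow> 'o"
  Idn :: "'o \<Rightarrow> 'a"
  Cmp :: "'a \<Rightarrow> 'a \<Rightarrow> 'a"  (infixl "\<cdot>\<index>" 70)

definition Hom :: "('o, 'a) cat \<Rightarrow> 'o \<Rightarrow> 'o \<Rightarrow> 'a set" where
  "Hom C a b = {f \<in> Arr C. Dom C f = a \<and> Cod C f = b}"

locale category =
  fixes C :: "('o, 'a) cat" (structure)
  assumes Dom_closed: "f \<in> Arr C \<Longrightarrow> Dom C f \<in> Obj C"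
    and Cod_closed: "f \<in> Arr C \<Longrightarrow> Cod C f \<in> Obj C"
    and Idn_Hom: "a \<in> Obj C \<Longrightarrow> Idn C a \<in> Hom C a a"
    and Cmp_Hom: "\<lbrakk>f \<in> Hom C a b; g \<in> Hom C b c\<rbrakk> \<Longrightarrow> g \<cdot> f \<in> Hom C a c"
    and Cmp_Idn: "f \<in> Hom C a b \<Longrightarrow> f \<cdot> Idn C a = f"
    and Idn_Cmp: "f \<in> Hom C a b \<Longrightarrow> Idn C b \<cdot> f = f"
    and Cmp_assoc: "\<lbrakk>f \<in> Hom C a b; g \<in> Hom C b c; h \<in> Hom C c d\<rbrakk>
      \<Longrightarrow> (h \<cdot> g) \<cdot> f = h \<cdot> (g \<cdot> f)"

definition prod_cat :: "('i, 'm) cat \<Rightarrow> ('j, 'n) cat \<Rightarrow> ('i \<times> 'j, 'm \<times> 'n) cat" where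
  "prod_cat C D =
    \<lparr>Obj = Obj C \<times> Obj D,
     Arr = Arr C \<times> Arr D,
     Dom = (\<lambda>(f, g). (Dom C f, Dom D g)),
     Cod = (\<lambda>(f, g). (Cod C f, Cod D g)),
     Idn = (\<lambda>(a, b). (Idn C a, Idn D b)),
     Cmp = (\<lambda>(f', g') (f, g). (Cmp C f' f, Cmp D g' g))\<rparr>"

datatype pp_obj = PSource | PTarget
datatype pp_arr = PId pp_obj | PLeft | PRight

definition parallel_pair :: "(pp_obj, pp_arr) cat" where
  "parallel_pair =
    \<lparr>Obj = UNIV,
     Arr = UNIV,
     Dom = (\<lambda>f. case f of PId a \<Rightarrow> a | _ \<Rightarrow> PSource),
     Cod = (\<lambda>f. case f of PId a \<Rightarrow> a | _ \<Rightarrow> PTarget),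
     Idn = PId,
     Cmp = (\<lambda>g f. case f of PId _ \<Rightarrow> g | _ \<Rightarrow> f)\<rparr>"

lemma category_parallel_pair: "category parallel_pair"
  by unfold_locales (auto simp: parallel_pair_def Hom_def split: pp_arr.splits)

lemma category_prod_cat:
  assumes "category C" and "category D"
  shows "category (prod_cat C D)"
proof -
  interpret C: category C by fact
  interpret D: category D by fact
  show ?thesis
    using C.Dom_closed D.Dom_closed C.Cod_closed D.Cod_closed C.Idn_Hom D.Idn_Hom
      C.Cmp_Hom D.Cmp_Hom C.Cmp_Idn D.Cmp_Idn C.Idn_Cmp D.Idn_Cmp C.Cmp_assoc D.Cmp_assoc
    by unfold_locales (auto simp: prod_cat_def Hom_def)
qed


section \<open>Set-valued functors, limits and colimits\<close>

text \<open>The elements of the sets are drawn from a type \<open>'u\<close>. Only the values of \<open>FArr F f\<close> on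
  \<open>FObj F (Dom C f)\<close> matter.\<close>

record ('o, 'a, 'u) sfun =
  FObj :: "'o \<Rightarrow> 'u set"
  FArr :: "'a \<Rightarrow> 'u \<Rightarrow> 'u"

locale set_functor = category C for C :: "('o, 'a) cat" (structure) +
  fixes F :: "('o, 'a, 'u) sfun"
  assumes FArr_closed: "f \<in> Arr C \<Longrightarrow> FArr F f \<in> FObj F (Dom C f) \<rightarrow> FObj F (Cod C f)"
    and FArr_Idn: "\<lbrakk>a \<in> Obj C; x \<in> FObj F a\<rbrakk> \<Longrightarrow> FArr F (Idn C a) x = x"
    and FArr_Cmp: "\<lbrakk>f \<in> Hom C a b; g \<in> Hom C b c; x \<in> FObj F a\<rbrakk>
      \<Longrightarrow> FArr F (g \<cdot> f) x = FArr F g (FArr F f x)"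

definition Lim :: "('o, 'a) cat \<Rightarrow> ('o, 'a, 'u) sfun \<Rightarrow> ('o \<Rightarrow> 'u) set" where
  "Lim C F = {x \<in> \<Pi>\<^sub>E a\<in>Obj C. FObj F a. \<forall>f\<in>Arr C. FArr F f (x (Dom C f)) = x (Cod C f)}"

text \<open>The colimit is the quotient of the disjoint union of the sets \<open>FObj F a\<close> by the equivalence
  relation generated by \<open>(Dom f, x) \<sim> (Cod f, F f x)\<close>.\<close>

definition colim_step :: "('o, 'a) cat \<Rightarrow> ('o, 'a, 'u) sfun \<Rightarrow> (('o \<times> 'u) \<times> ('o \<times> 'u)) set" where
  "colim_step C F = {((Dom C f, x), (Cod C f, FArr F f x)) | f x. f \<in> Arr C \<and> x \<in> FObj F (Dom C f)}"

definition colim_rel :: "('o, 'a) cat \<Rightarrow> ('o, 'a, 'u) sfun \<Rightarrow> (('o \<times> 'u) \<times> ('o \<times> 'u)) set" where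
  "colim_rel C F =
    (colim_step C F \<union> (colim_step C F)\<inverse>)\<^sup>* \<inter> (Sigma (Obj C) (FObj F) \<times> Sigma (Obj C) (FObj F))"

definition Colim :: "('o, 'a) cat \<Rightarrow> ('o, 'a, 'u) sfun \<Rightarrow> ('o \<times> 'u) set set" where
  "Colim C F = Sigma (Obj C) (FObj F) // colim_rel C F"

text \<open>The map into the colimit of \<open>G\<close> induced by a natural transformation \<open>t\<close>, sending the class of
  \<open>(a, x)\<close> to the class of \<open>(a, t a x)\<close>.\<close>

definition colim_map ::
  "('o, 'a) cat \<Rightarrow> ('o, 'a, 'v) sfun \<Rightarrow> ('o \<Rightarrow> 'u \<Rightarrow> 'v) \<Rightarrow> ('o \<times> 'u) set \<Rightarrow> ('o \<times> 'v) set" where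
  "colim_map C G t c = colim_rel C G `` ((\<lambda>(a, x). (a, t a x)) ` c)"

lemma equiv_colim_rel: "equiv (Sigma (Obj C) (FObj F)) (colim_rel C F)"
proof (rule equivI)
  have "sym ((colim_step C F \<union> (colim_step C F)\<inverse>)\<^sup>*)"
    by (intro sym_rtrancl sym_Un_converse)
  then show "sym (colim_rel C F)"
    unfolding colim_rel_def by (auto simp: sym_def)
  show "trans (colim_rel C F)"
    unfolding colim_rel_def trans_def by (auto intro: rtrancl_trans)
qed (auto simp: colim_rel_def refl_on_def)

lemma colim_map_class:
  assumes t: "\<And>a x. \<lbrakk>a \<in> Obj C; x \<in> FObj F a\<rbrakk> \<Longrightarrow> t a x \<in> FObj G a"
    and nat: "\<And>f x. \<lbrakk>f \<in> Arr C; x \<in> FObj F (Dom C f)\<rbrakk>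
      \<Longrightarrow> t (Cod C f) (FArr F f x) = FArr G f (t (Dom C f) x)"
    and C: "category C"
    and a: "a \<in> Obj C" "x \<in> FObj F a"
  shows "colim_map C G t (colim_rel C F `` {(a, x)}) = colim_rel C G `` {(a, t a x)}"
proof -
  interpret category C by fact
  let ?h = "\<lambda>(a, x). (a, t a x)"
  have step: "(?h p, ?h q) \<in> colim_step C G" if "(p, q) \<in> colim_step C F" for p q
    using that t nat Dom_closed unfolding colim_step_def by fastforce
  have "(?h p, ?h q) \<in> (colim_step C G \<union> (colim_step C G)\<inverse>)\<^sup>*"
    if "(p, q) \<in> (colim_step C F \<union> (colim_step C F)\<inverse>)\<^sup>*" for p q
    using that
  proof induction
    case (step q r)
    then have "(?h q, ?h r) \<in> colim_step C G \<union> (colim_step C G)\<inverse>"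
      using \<open>\<And>p q. (p, q) \<in> colim_step C F \<Longrightarrow> _\<close> by blast
    with step.IH show ?case by (rule rtrancl_into_rtrancl)
  qed simp
  then have rel: "(?h p, ?h q) \<in> colim_rel C G" if "(p, q) \<in> colim_rel C F" for p q
    using that t unfolding colim_rel_def by fastforce
  have equiv: "sym (colim_rel C G)" "trans (colim_rel C G)"
    using equiv_colim_rel[of C G] by (auto elim: equivE)
  have self: "(a, x) \<in> colim_rel C F `` {(a, x)}"
    using equiv_class_self[OF equiv_colim_rel] a by fast
  show ?thesis
    unfolding colim_map_def
  proof
    show "colim_rel C G `` (?h ` (colim_rel C F `` {(a, x)})) \<subseteq> colim_rel C G `` {(a, t a x)}"
    proof
      fix q assume "q \<in> colim_rel C G `` (?h ` (colim_rel C F `` {(a, x)}))"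
      then obtain p where "((a, x), p) \<in> colim_rel C F" "(?h p, q) \<in> colim_rel C G"
        by blast
      then show "q \<in> colim_rel C G `` {(a, t a x)}"
        using rel[of "(a, x)" p] transD[OF equiv(2)] by auto
    qed
    show "colim_rel C G `` {(a, t a x)} \<subseteq> colim_rel C G `` (?h ` (colim_rel C F `` {(a, x)}))"
      using imageI[OF self, of ?h] by (intro Image_mono) auto
  qed
qed


section \<open>Commutation of limits with colimits\<close>

text \<open>A functor \<open>F\<close> on \<open>I \<times> J\<close> restricts to functors in each variable.\<close>

definition fix_fst :: "('i, 'm) cat \<Rightarrow> ('i \<times> 'j, 'm \<times> 'n, 'u) sfun \<Rightarrow> 'i \<Rightarrow> ('j, 'n, 'u) sfun" where
  "fix_fst I F i = \<lparr>FObj = (\<lambda>j. FObj F (i, j)), FArr = (\<lambda>g. FArr F (Idn I i, g))\<rparr>"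

definition fix_snd :: "('j, 'n) cat \<Rightarrow> ('i \<times> 'j, 'm \<times> 'n, 'u) sfun \<Rightarrow> 'j \<Rightarrow> ('i, 'm, 'u) sfun" where
  "fix_snd J F j = \<lparr>FObj = (\<lambda>i. FObj F (i, j)), FArr = (\<lambda>f. FArr F (f, Idn J j))\<rparr>"

definition lim_functor ::
  "('i, 'm) cat \<Rightarrow> ('j, 'n) cat \<Rightarrow> ('i \<times> 'j, 'm \<times> 'n, 'u) sfun \<Rightarrow> ('j, 'n, 'i \<Rightarrow> 'u) sfun" where
  "lim_functor I J F =
    \<lparr>FObj = (\<lambda>j. Lim I (fix_snd J F j)),
     FArr = (\<lambda>g x. \<lambda>i\<in>Obj I. FArr F (Idn I i, g) (x i))\<rparr>"

definition colim_functor ::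
  "('i, 'm) cat \<Rightarrow> ('j, 'n) cat \<Rightarrow> ('i \<times> 'j, 'm \<times> 'n, 'u) sfun \<Rightarrow> ('i, 'm, ('j \<times> 'u) set) sfun" where
  "colim_functor I J F =
    \<lparr>FObj = (\<lambda>i. Colim J (fix_fst I F i)),
     FArr = (\<lambda>f. colim_map J (fix_fst I F (Cod I f)) (\<lambda>j. FArr F (f, Idn J j)))\<rparr>"

text \<open>The class of \<open>(j, (x\<^sub>i)\<^sub>i)\<close> is sent to the family of the classes of \<open>(j, x\<^sub>i)\<close>.\<close>

definition canonical_map ::
  "('i, 'm) cat \<Rightarrow> ('j, 'n) cat \<Rightarrow> ('i \<times> 'j, 'm \<times> 'n, 'u) sfun
    \<Rightarrow> ('j \<times> ('i \<Rightarrow> 'u)) set \<Rightarrow> 'i \<Rightarrow> ('j \<times> 'u) set" where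
  "canonical_map I J F c = (\<lambda>i\<in>Obj I. colim_map J (fix_fst I F i) (\<lambda>j x. x i) c)"

lemma set_functor_lim_functor:
  assumes "category I" and "category J" and "set_functor (prod_cat I J) F"
  shows "set_functor J (lim_functor I J F)"
proof -
  interpret I: category I by fact
  interpret J: category J by fact
  interpret F: set_functor "prod_cat I J" F by fact
  have commute: "FArr F (Idn I (Cod I f), g) (FArr F (f, Idn J (Dom J g)) x)
      = FArr F (f, Idn J (Cod J g)) (FArr F (Idn I (Dom I f), g) x)"
    if "f \<in> Arr I" "g \<in> Arr J" "x \<in> FObj F (Dom I f, Dom J g)" for f g x
  proof -
    have f: "f \<in> Hom I (Dom I f) (Cod I f)" and g: "g \<in> Hom J (Dom J g) (Cod J g)"
      using that by (auto simp: Hom_def)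
    show ?thesis
      using that f g I.Dom_closed I.Cod_closed J.Dom_closed J.Cod_closed
        I.Idn_Hom[of "Dom I f"] I.Idn_Hom[of "Cod I f"] J.Idn_Hom[of "Dom J g"] J.Idn_Hom[of "Cod J g"]
        F.FArr_Cmp[of "(f, Idn J (Dom J g))" "(Dom I f, Dom J g)" "(Cod I f, Dom J g)"
          "(Idn I (Cod I f), g)" "(Cod I f, Cod J g)" x]
        F.FArr_Cmp[of "(Idn I (Dom I f), g)" "(Dom I f, Dom J g)" "(Dom I f, Cod J g)"
          "(f, Idn J (Cod J g))" "(Cod I f, Cod J g)" x]
        I.Cmp_Idn[OF f] I.Idn_Cmp[OF f] J.Cmp_Idn[OF g] J.Idn_Cmp[OF g]
      by (simp add: prod_cat_def Hom_def)
  qed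
  have closed: "FArr F (f, g) x \<in> FObj F (Cod I f, Cod J g)"
    if "f \<in> Arr I" "g \<in> Arr J" "x \<in> FObj F (Dom I f, Dom J g)" for f g x
    using F.FArr_closed[of "(f, g)"] that by (auto simp: prod_cat_def)
  show ?thesis
  proof unfold_locales
    fix g assume g: "g \<in> Arr J"
    show "FArr (lim_functor I J F) g \<in> FObj (lim_functor I J F) (Dom J g) \<rightarrow> FObj (lim_functor I J F) (Cod J g)"
    proof
      fix x assume "x \<in> FObj (lim_functor I J F) (Dom J g)"
      then have x: "\<And>i. i \<in> Obj I \<Longrightarrow> x i \<in> FObj F (i, Dom J g)"
        "\<And>f. f \<in> Arr I \<Longrightarrow> FArr F (f, Idn J (Dom J g)) (x (Dom I f)) = x (Cod I f)"
        by (auto simp: lim_functor_def Lim_def fix_snd_def)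
      have "FArr F (Idn I i, g) (x i) \<in> FObj F (i, Cod J g)" if "i \<in> Obj I" for i
        using closed[of "Idn I i" g "x i"] x(1)[OF that] I.Idn_Hom[OF that] g by (simp add: Hom_def)
      then show "FArr (lim_functor I J F) g x \<in> FObj (lim_functor I J F) (Cod J g)"
        using commute[OF _ g] x I.Dom_closed I.Cod_closed
        by (auto simp: lim_functor_def Lim_def fix_snd_def) metis
    qed
  next
    fix j x assume "j \<in> Obj J" "x \<in> FObj (lim_functor I J F) j"
    then show "FArr (lim_functor I J F) (Idn J j) x = x"
      using F.FArr_Idn
      by (fastforce simp: lim_functor_def Lim_def fix_snd_def prod_cat_def PiE_def extensional_def)
  next
    fix g a b h c x
    assume "g \<in> Hom J a b" "h \<in> Hom J b c" "x \<in> FObj (lim_functor I J F) a"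
    moreover from this have
      "FArr F (Idn I i, Cmp J h g) (x i) = FArr F (Idn I i, h) (FArr F (Idn I i, g) (x i))"
      if "i \<in> Obj I" for i
      using F.FArr_Cmp[of "(Idn I i, g)" "(i, a)" "(i, b)" "(Idn I i, h)" "(i, c)" "x i"]
        I.Idn_Hom[OF that] I.Cmp_Idn[OF I.Idn_Hom[OF that]] that
      by (auto simp: lim_functor_def Lim_def fix_snd_def prod_cat_def Hom_def PiE_iff)
    ultimately show "FArr (lim_functor I J F) (Cmp J h g) x
        = FArr (lim_functor I J F) h (FArr (lim_functor I J F) g x)"
      by (auto simp: lim_functor_def)
  qed
qed

lemma canonical_map_class:
  assumes "category I" and "category J" and "set_functor (prod_cat I J) F"
    and "j \<in> Obj J" and "x \<in> Lim I (fix_snd J F j)"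
  shows "canonical_map I J F (colim_rel J (lim_functor I J F) `` {(j, x)})
    = (\<lambda>i\<in>Obj I. colim_rel J (fix_fst I F i) `` {(j, x i)})"
  unfolding canonical_map_def
  by (intro restrict_ext colim_map_class)
    (use assms category.Dom_closed in
      \<open>auto simp: lim_functor_def fix_fst_def fix_snd_def Lim_def\<close>)

text \<open>HOL cannot quantify over types in a hypothesis, so \<open>Set\<close> is the category of the sets with
  elements in \<open>'u\<close>, and \<open>'u\<close> is a parameter of the following notions.\<close>

definition limits_commute_with_colimits ::
  "'u itself \<Rightarrow> ('i, 'm) cat \<Rightarrow> ('j, 'n) cat \<Rightarrow> bool" where
  "limits_commute_with_colimits U I J \<longleftrightarrow>
    (\<forall>F :: ('i \<times> 'j, 'm \<times> 'n, 'u) sfun. set_functor (prod_cat I J) F \<longrightarrow>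
      bij_betw (canonical_map I J F) (Colim J (lim_functor I J F)) (Lim I (colim_functor I J F)))"

definition colimits_commute_with_equalizers :: "'u itself \<Rightarrow> ('j, 'n) cat \<Rightarrow> bool" where
  "colimits_commute_with_equalizers U J \<longleftrightarrow> limits_commute_with_colimits U parallel_pair J"

text \<open>\<open>'u\<close> serves as the universe with respect to which \<open>C\<close> is small. Only two closure properties
  of a universe are demanded: it is infinite, and it contains a copy of the set of arrows of \<open>C\<close>
  (hence, via identities, also of the set of objects).\<close>

definition small_cat :: "'u itself \<Rightarrow> ('o, 'a) cat \<Rightarrow> bool" where
  "small_cat U C \<longleftrightarrow>
    category C \<and> infinite (UNIV :: 'u set) \<and> (\<exists>\<iota> :: 'a \<Rightarrow> 'u. inj_on \<iota> (Arr C))"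


section \<open>Pseudo-filtered categories\<close>

definition filtered :: "('o, 'a) cat \<Rightarrow> bool" where
  "filtered C \<longleftrightarrow>
    Obj C \<noteq> {} \<and>
    (\<forall>a\<in>Obj C. \<forall>b\<in>Obj C. \<exists>c\<in>Obj C. Hom C a c \<noteq> {} \<and> Hom C b c \<noteq> {}) \<and>
    (\<forall>a\<in>Obj C. \<forall>b\<in>Obj C. \<forall>f\<in>Hom C a b. \<forall>g\<in>Hom C a b.
      \<exists>c\<in>Obj C. \<exists>h\<in>Hom C b c. h \<cdot>\<^bsub>C\<^esub> f = h \<cdot>\<^bsub>C\<^esub> g)"

definition arrow_rel :: "('o, 'a) cat \<Rightarrow> ('o \<times> 'o) set" where
  "arrow_rel C = {(Dom C f, Cod C f) | f. f \<in> Arr C}"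

definition connected_rel :: "('o, 'a) cat \<Rightarrow> ('o \<times> 'o) set" where
  "connected_rel C = (arrow_rel C \<union> (arrow_rel C)\<inverse>)\<^sup>* \<inter> (Obj C \<times> Obj C)"

definition full_subcat :: "('o, 'a) cat \<Rightarrow> 'o set \<Rightarrow> ('o, 'a) cat" where
  "full_subcat C K = C\<lparr>Obj := K, Arr := {f \<in> Arr C. Dom C f \<in> K \<and> Cod C f \<in> K}\<rparr>"

definition connected_components :: "('o, 'a) cat \<Rightarrow> ('o, 'a) cat set" where
  "connected_components C = full_subcat C ` (Obj C // connected_rel C)"

definition pseudo_filtered :: "('o, 'a) cat \<Rightarrow> bool" where
  "pseudo_filtered C \<longleftrightarrow> (\<forall>D\<in>connected_components C. filtered D)"

end

theory Submission
  imports Defs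
begin

text \<open>The colimit of a representable functor is a point. For parallel arrows \<open>f, g : a \<rightarrow> b\<close>, apply
  surjectivity of the canonical map to the two transformations \<open>Hom(b, -) \<Rightarrow> Hom(a, -)\<close> given by
  precomposition: their equalizer has a nonempty colimit, hence some \<open>h\<close> satisfies \<open>h f = h g\<close>.

  Every subfunctor \<open>S\<close> of \<open>Hom(a, -)\<close> is the equalizer of the two inclusions of \<open>Hom(a, -)\<close> into the
  pushout of two copies of it along \<open>S\<close>, so by injectivity its colimit has at most one point. For
  a span \<open>f : a \<rightarrow> b\<close>, \<open>g : a \<rightarrow> c\<close> take \<open>S\<close> to consist of the arrows that factor through \<open>f\<close> or through
  \<open>g\<close>: if no square completed the span, \<open>S\<close> would be the disjoint union of two nonempty
  subfunctors. Completing spans along a zigzag gives upper bounds of connected objects.\<close>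

section \<open>Natural transformations and colimits\<close>

definition natural ::
  "('o, 'a) cat \<Rightarrow> ('o, 'a, 'u) sfun \<Rightarrow> ('o, 'a, 'v) sfun \<Rightarrow> ('o \<Rightarrow> 'u \<Rightarrow> 'v) \<Rightarrow> bool" where
  "natural C F G t \<longleftrightarrow>
    (\<forall>a\<in>Obj C. t a \<in> FObj F a \<rightarrow> FObj G a) \<and>
    (\<forall>f\<in>Arr C. \<forall>x\<in>FObj F (Dom C f). t (Cod C f) (FArr F f x) = FArr G f (t (Dom C f) x))"

lemma colim_map_natural:
  assumes "natural C F G t" and "category C" and "a \<in> Obj C" and "x \<in> FObj F a"
  shows "colim_map C G t (colim_rel C F `` {(a, x)}) = colim_rel C G `` {(a, t a x)}"
  by (rule colim_map_class) (use assms in \<open>auto simp: natural_def\<close>)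

lemma colim_rel_mem:
  assumes "((a, x), (b, y)) \<in> colim_rel C F"
  shows "a \<in> Obj C" "b \<in> Obj C" "x \<in> FObj F a" "y \<in> FObj F b"
  using assms by (auto simp: colim_rel_def)

lemma colim_rel_class_eq:
  assumes "a \<in> Obj C" "x \<in> FObj F a" "b \<in> Obj C" "y \<in> FObj F b"
  shows "colim_rel C F `` {(a, x)} = colim_rel C F `` {(b, y)} \<longleftrightarrow> ((a, x), (b, y)) \<in> colim_rel C F"
  by (rule eq_equiv_class_iff[OF equiv_colim_rel]) (use assms in auto)

lemma colim_rel_natural:
  assumes "natural C F G t" and "category C" and rel: "((a, x), (b, y)) \<in> colim_rel C F"
  shows "((a, t a x), (b, t b y)) \<in> colim_rel C G"
proof -
  note mem = colim_rel_mem[OF rel]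
  have "colim_rel C F `` {(a, x)} = colim_rel C F `` {(b, y)}"
    using colim_rel_class_eq mem rel by metis
  then have "colim_rel C G `` {(a, t a x)} = colim_rel C G `` {(b, t b y)}"
    using colim_map_natural[OF assms(1,2)] mem by metis
  moreover have "t a x \<in> FObj G a" "t b y \<in> FObj G b"
    using assms(1) mem by (auto simp: natural_def)
  ultimately show ?thesis
    using colim_rel_class_eq mem by metis
qed

lemma colim_rel_arr:
  assumes "set_functor C F" and "f \<in> Hom C a b" and "x \<in> FObj F a"
  shows "((a, x), (b, FArr F f x)) \<in> colim_rel C F"
proof -
  interpret set_functor C F by fact
  show ?thesis
    using assms(2,3) FArr_closed[of f] Dom_closed[of f] Cod_closed[of f]
    unfolding colim_rel_def colim_step_def Hom_def
    by (fastforce intro!: r_into_rtrancl)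
qed

lemma colim_rel_sym: "(p, q) \<in> colim_rel C F \<Longrightarrow> (q, p) \<in> colim_rel C F"
  using equiv_colim_rel[of C F] by (auto elim: equivE dest: symD)

lemma colim_rel_trans:
  "(p, q) \<in> colim_rel C F \<Longrightarrow> (q, r) \<in> colim_rel C F \<Longrightarrow> (p, r) \<in> colim_rel C F"
  using equiv_colim_rel[of C F] by (auto elim: equivE dest: transD)

text \<open>This serves to show that two elements are not identified in a colimit: a predicate
  preserved and reflected by every transition map is constant along zigzags. The predicate sees only
  the element and not its index, which is enough when elements encode arrows.\<close>

lemma colim_rel_invariant:
  assumes "((a, x), (b, y)) \<in> colim_rel C F"
    and "\<And>f x. f \<in> Arr C \<Longrightarrow> x \<in> FObj F (Dom C f) \<Longrightarrow> P (FArr F f x) \<longleftrightarrow> P x"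
  shows "P x \<longleftrightarrow> P y"
proof -
  have "((a, x), (b, y)) \<in> (colim_step C F \<union> (colim_step C F)\<inverse>)\<^sup>*"
    using assms(1) by (simp add: colim_rel_def)
  then have "P (snd (a, x)) \<longleftrightarrow> P (snd (b, y))"
    by induction (use assms(2) in \<open>auto simp: colim_step_def\<close>)
  then show ?thesis by simp
qed


text \<open>The counterpart of \<open>canonical_map_class\<close> for the transition maps between
  the colimits. Such a map is computed on representatives because the action of \<open>m\<close> is
  natural in the second variable.\<close>

lemma colim_functor_class:
  assumes "category I" and "category J" and "set_functor (prod_cat I J) F"
    and j: "j \<in> Obj J" and m: "m \<in> Arr I" and x: "x \<in> FObj F (Dom I m, j)"
  shows "FArr (colim_functor I J F) m (colim_rel J (fix_fst I F (Dom I m)) `` {(j, x)})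
    = colim_rel J (fix_fst I F (Cod I m)) `` {(j, FArr F (m, Idn J j) x)}"
proof -
  interpret I: category I by fact
  interpret J: category J by fact
  interpret F: set_functor "prod_cat I J" F by fact
  have closed: "FArr F (m, Idn J a) y \<in> FObj F (Cod I m, a)"
    if "a \<in> Obj J" "y \<in> FObj F (Dom I m, a)" for a y
    using F.FArr_closed[of "(m, Idn J a)"] J.Idn_Hom[of a] m that by (auto simp: prod_cat_def Hom_def)
  \<comment> \<open>Both sides are the action of \<open>(m, g)\<close>, factored in the product
    category in the two possible orders.\<close>
  have commute: "FArr F (m, Idn J (Cod J g)) (FArr F (Idn I (Dom I m), g) y)
      = FArr F (Idn I (Cod I m), g) (FArr F (m, Idn J (Dom J g)) y)"
    if "g \<in> Arr J" "y \<in> FObj F (Dom I m, Dom J g)" for g y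
  proof -
    have m': "m \<in> Hom I (Dom I m) (Cod I m)" and g: "g \<in> Hom J (Dom J g) (Cod J g)"
      using that m by (auto simp: Hom_def)
    show ?thesis
      using that m m' g I.Dom_closed I.Cod_closed J.Dom_closed J.Cod_closed
        I.Idn_Hom[of "Dom I m"] I.Idn_Hom[of "Cod I m"] J.Idn_Hom[of "Dom J g"] J.Idn_Hom[of "Cod J g"]
        F.FArr_Cmp[of "(m, Idn J (Dom J g))" "(Dom I m, Dom J g)" "(Cod I m, Dom J g)"
          "(Idn I (Cod I m), g)" "(Cod I m, Cod J g)" y]
        F.FArr_Cmp[of "(Idn I (Dom I m), g)" "(Dom I m, Dom J g)" "(Dom I m, Cod J g)"
          "(m, Idn J (Cod J g))" "(Cod I m, Cod J g)" y]
        I.Cmp_Idn[OF m'] I.Idn_Cmp[OF m'] J.Cmp_Idn[OF g] J.Idn_Cmp[OF g]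
      by (simp add: prod_cat_def Hom_def)
  qed
  have "natural J (fix_fst I F (Dom I m)) (fix_fst I F (Cod I m)) (\<lambda>j. FArr F (m, Idn J j))"
    using closed commute by (auto simp: natural_def fix_fst_def)
  from colim_map_natural[OF this \<open>category J\<close> j] x show ?thesis
    by (simp add: colim_functor_def fix_fst_def)
qed


section \<open>Parallel pairs of natural transformations\<close>

text \<open>A functor on the product with the parallel pair amounts to two natural transformations
  \<open>s\<close>, \<open>t\<close> from \<open>X\<close> to \<open>Y\<close>. An arrow
  \<open>(PLeft, g)\<close> or \<open>(PRight, g)\<close> acts by the diagonal of a naturality
  square, here taken through \<open>Y\<close>.\<close>

definition pair_functor ::
  "('o, 'a) cat \<Rightarrow> ('o, 'a, 'u) sfun \<Rightarrow> ('o, 'a, 'u) sfun \<Rightarrow> ('o \<Rightarrow> 'u \<Rightarrow> 'u) \<Rightarrow> ('o \<Rightarrow> 'u \<Rightarrow> 'u)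
    \<Rightarrow> (pp_obj \<times> 'o, pp_arr \<times> 'a, 'u) sfun" where
  "pair_functor C X Y s t =
    \<lparr>FObj = (\<lambda>(i, j). case i of PSource \<Rightarrow> FObj X j | PTarget \<Rightarrow> FObj Y j),
     FArr = (\<lambda>(m, g) x. case m of
       PId i \<Rightarrow> (case i of PSource \<Rightarrow> FArr X g x | PTarget \<Rightarrow> FArr Y g x)
     | PLeft \<Rightarrow> FArr Y g (s (Dom C g) x)
     | PRight \<Rightarrow> FArr Y g (t (Dom C g) x))\<rparr>"

definition equalizer :: "('o, 'a, 'u) sfun \<Rightarrow> ('o \<Rightarrow> 'u \<Rightarrow> 'v) \<Rightarrow> ('o \<Rightarrow> 'u \<Rightarrow> 'v) \<Rightarrow> ('o, 'a, 'u) sfun" where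
  "equalizer X s t = \<lparr>FObj = (\<lambda>j. {x \<in> FObj X j. s j x = t j x}), FArr = FArr X\<rparr>"

lemma parallel_pair_simps:
  "Obj parallel_pair = UNIV" "Arr parallel_pair = UNIV" "Idn parallel_pair = PId"
  "Dom parallel_pair (PId i) = i" "Cod parallel_pair (PId i) = i"
  "Dom parallel_pair PLeft = PSource" "Cod parallel_pair PLeft = PTarget"
  "Dom parallel_pair PRight = PSource" "Cod parallel_pair PRight = PTarget"
  by (simp_all add: parallel_pair_def)

lemma fix_fst_pair_functor:
  "fix_fst parallel_pair (pair_functor C X Y s t) PSource = X"
  "fix_fst parallel_pair (pair_functor C X Y s t) PTarget = Y"
  by (simp_all add: fix_fst_def pair_functor_def parallel_pair_def)

locale natural_pair =
  X: set_functor C X + Y: set_functor C Y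
  for C :: "('o, 'a) cat" (structure) and X Y :: "('o, 'a, 'u) sfun" +
  fixes s t :: "'o \<Rightarrow> 'u \<Rightarrow> 'u"
  assumes natural_s: "natural C X Y s" and natural_t: "natural C X Y t"
begin

abbreviation F where "F \<equiv> pair_functor C X Y s t"

lemma s_closed: "a \<in> Obj C \<Longrightarrow> x \<in> FObj X a \<Longrightarrow> s a x \<in> FObj Y a"
  and t_closed: "a \<in> Obj C \<Longrightarrow> x \<in> FObj X a \<Longrightarrow> t a x \<in> FObj Y a"
  using natural_s natural_t by (auto simp: natural_def)

lemma s_nat: "f \<in> Hom C a b \<Longrightarrow> x \<in> FObj X a \<Longrightarrow> s b (FArr X f x) = FArr Y f (s a x)"
  and t_nat: "f \<in> Hom C a b \<Longrightarrow> x \<in> FObj X a \<Longrightarrow> t b (FArr X f x) = FArr Y f (t a x)"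
  using natural_s natural_t by (auto simp: natural_def Hom_def)

lemma set_functor_pair: "set_functor (prod_cat parallel_pair C) F"
proof -
  interpret P: category "prod_cat parallel_pair C"
    by (intro category_prod_cat category_parallel_pair X.category_axioms)
  have X_closed: "FArr X g x \<in> FObj X (Cod C g)" if "g \<in> Arr C" "x \<in> FObj X (Dom C g)" for g x
    using X.FArr_closed that by blast
  have Y_closed: "FArr Y g x \<in> FObj Y (Cod C g)" if "g \<in> Arr C" "x \<in> FObj Y (Dom C g)" for g x
    using Y.FArr_closed that by blast
  show ?thesis
  proof unfold_locales
    fix m assume "m \<in> Arr (prod_cat parallel_pair C)"
    then show "FArr F m \<in> FObj F (Dom (prod_cat parallel_pair C) m)
        \<rightarrow> FObj F (Cod (prod_cat parallel_pair C) m)"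
      by (cases m)
        (auto simp: prod_cat_def parallel_pair_def pair_functor_def split: pp_arr.splits pp_obj.splits
          intro!: X_closed Y_closed s_closed t_closed X.Dom_closed)
  next
    fix p x assume "p \<in> Obj (prod_cat parallel_pair C)" "x \<in> FObj F p"
    then show "FArr F (Idn (prod_cat parallel_pair C) p) x = x"
      by (cases p)
        (auto simp: prod_cat_def parallel_pair_def pair_functor_def X.FArr_Idn Y.FArr_Idn
          split: pp_obj.splits)
  next
    fix m p q n r x
    assume *: "m \<in> Hom (prod_cat parallel_pair C) p q" "n \<in> Hom (prod_cat parallel_pair C) q r"
      "x \<in> FObj F p"
    obtain m1 f where m: "m = (m1, f)" by force
    obtain n1 g where n: "n = (n1, g)" by force
    obtain i a where p: "p = (i, a)" by force
    obtain j b where q: "q = (j, b)" by force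
    obtain k c where r: "r = (k, c)" by force
    have f: "f \<in> Hom C a b" and g: "g \<in> Hom C b c"
      using * by (auto simp: Hom_def prod_cat_def m n p q r)
    have gf: "Cmp C g f \<in> Hom C a c" using X.Cmp_Hom f g by blast
    have D: "Dom C f = a" "Dom C g = b" "Dom C (Cmp C g f) = a" "a \<in> Obj C"
      using f g gf X.Dom_closed by (auto simp: Hom_def)
    show "FArr F (Cmp (prod_cat parallel_pair C) n m) x = FArr F n (FArr F m x)"
      using * D X.FArr_Cmp[OF f g] Y.FArr_Cmp[OF f g] s_closed t_closed s_nat[OF f] t_nat[OF f]
      by (auto simp: Hom_def prod_cat_def parallel_pair_def pair_functor_def m n p q r
          split: pp_arr.splits pp_obj.splits)
  qed
qed

text \<open>The left arrow forces the component at \<open>PTarget\<close>, and the right arrow then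
  says that \<open>s\<close> and \<open>t\<close> agree at the component at \<open>PSource\<close>.
  So limits over the parallel pair are pointwise equalizers.\<close>

lemma lim_functor_iff:
  assumes "j \<in> Obj C"
  shows "x \<in> FObj (lim_functor parallel_pair C F) j \<longleftrightarrow>
    x PSource \<in> FObj (equalizer X s t) j \<and> x PTarget = s j (x PSource)"
proof -
  have Idn: "Dom C (Idn C j) = j" using X.Idn_Hom[OF assms] by (simp add: Hom_def)
  have all_obj: "(\<forall>i. P i) \<longleftrightarrow> P PSource \<and> P PTarget" for P
    by (metis pp_obj.exhaust)
  have all_arr: "(\<forall>m. P m) \<longleftrightarrow> (\<forall>i. P (PId i)) \<and> P PLeft \<and> P PRight" for P
    by (metis pp_arr.exhaust)
  show ?thesis
    unfolding lim_functor_def Lim_def fix_snd_def equalizer_def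
    using assms s_closed t_closed
    by (auto simp: parallel_pair_def pair_functor_def Idn X.FArr_Idn Y.FArr_Idn all_obj all_arr
      PiE_def Pi_def extensional_def)
qed

text \<open>Used to carry identifications in the colimit of the limit functor over to the colimit of
  the equalizer.\<close>

lemma natural_eval:
  "natural C (lim_functor parallel_pair C F) (equalizer X s t) (\<lambda>j x. x PSource)"
  unfolding natural_def
  by (auto simp: lim_functor_iff)
    (simp add: lim_functor_def equalizer_def pair_functor_def parallel_pair_def)

text \<open>The class of \<open>x\<close> need only be equalized by the maps induced on colimits,
  although \<open>s\<close> and \<open>t\<close> may differ at \<open>x\<close> itself. This
  produces the points of the limit of colimits to which surjectivity is applied.\<close>

lemma class_lim_mem:
  assumes j: "j \<in> Obj C" and x: "x \<in> FObj X j" and st: "((j, s j x), (j, t j x)) \<in> colim_rel C Y"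
  shows "case_pp_obj (colim_rel C X `` {(j, x)}) (colim_rel C Y `` {(j, s j x)})
    \<in> Lim parallel_pair (colim_functor parallel_pair C F)"
    (is "?c \<in> _")
proof -
  have class_st: "colim_rel C Y `` {(j, s j x)} = colim_rel C Y `` {(j, t j x)}"
    using colim_rel_class_eq st j x s_closed t_closed by metis
  have Idn: "Dom C (Idn C j) = j" using X.Idn_Hom[OF j] by (simp add: Hom_def)
  have F_arr: "FArr F (PId PSource, Idn C j) x = x" "FArr F (PId PTarget, Idn C j) (s j x) = s j x"
    "FArr F (PLeft, Idn C j) x = s j x" "FArr F (PRight, Idn C j) x = t j x"
    using j x s_closed t_closed by (simp_all add: pair_functor_def Idn X.FArr_Idn Y.FArr_Idn)
  note colim_arr = colim_functor_class[OF category_parallel_pair X.category_axioms set_functor_pair j]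
  have "FArr (colim_functor parallel_pair C F) m (?c (Dom parallel_pair m)) = ?c (Cod parallel_pair m)"
    for m
  proof (cases m)
    case (PId i)
    then show ?thesis
      using colim_arr[of "PId i" "case i of PSource \<Rightarrow> x | PTarget \<Rightarrow> s j x"] x s_closed[OF j x] F_arr
      by (cases i) (simp_all add: parallel_pair_simps fix_fst_pair_functor, simp_all add: pair_functor_def)
  next
    case PLeft
    then show ?thesis
      using colim_arr[of PLeft x] x F_arr
      by (simp add: parallel_pair_simps fix_fst_pair_functor) (simp add: pair_functor_def)
  next
    case PRight
    then show ?thesis
      using colim_arr[of PRight x] x F_arr class_st
      by (simp add: parallel_pair_simps fix_fst_pair_functor) (simp add: pair_functor_def)
  qed
  then show ?thesis
    using j x s_closed
    by (auto simp: Lim_def colim_functor_def parallel_pair_simps fix_fst_pair_functor Colim_def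
      split: pp_obj.splits intro!: quotientI)
qed

text \<open>The surjective half of commutation: the compatible family given by \<open>x\<close> has
  a preimage, and the source component of a representative of it is the required
  \<open>y\<close>.\<close>

lemma coequalized_has_equalizer:
  assumes surj: "canonical_map parallel_pair C F ` Colim C (lim_functor parallel_pair C F)
      = Lim parallel_pair (colim_functor parallel_pair C F)"
    and "j \<in> Obj C" and "x \<in> FObj X j" and "((j, s j x), (j, t j x)) \<in> colim_rel C Y"
  obtains k y where "k \<in> Obj C" "y \<in> FObj (equalizer X s t) k" "((j, x), (k, y)) \<in> colim_rel C X"
proof -
  obtain c where c: "c \<in> Colim C (lim_functor parallel_pair C F)"
    and eq: "canonical_map parallel_pair C F c
      = case_pp_obj (colim_rel C X `` {(j, x)}) (colim_rel C Y `` {(j, s j x)})"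
    using class_lim_mem[OF assms(2-)] unfolding surj[symmetric] by auto
  obtain k z where k: "k \<in> Obj C" and z: "z \<in> FObj (lim_functor parallel_pair C F) k"
    and c_eq: "c = colim_rel C (lim_functor parallel_pair C F) `` {(k, z)}"
    using c unfolding Colim_def by (auto elim!: quotientE)
  have y: "z PSource \<in> FObj (equalizer X s t) k"
    using z lim_functor_iff k by blast
  have "canonical_map parallel_pair C F c PSource = colim_rel C X `` {(k, z PSource)}"
    using canonical_map_class[OF category_parallel_pair X.category_axioms set_functor_pair k, of z] z
    by (simp add: c_eq lim_functor_def parallel_pair_simps fix_fst_pair_functor)
  then have "((j, x), (k, z PSource)) \<in> colim_rel C X"
    using eq colim_rel_class_eq[OF assms(2,3) k, of "z PSource"] y by (simp add: equalizer_def)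
  with k y show thesis by (rule that)
qed

text \<open>The injective half of commutation: the colimit of the equalizer embeds in that of
  \<open>X\<close>. The points of the limit functor over \<open>x\<close> and \<open>y\<close> have
  the same image, at \<open>PSource\<close> by \<open>rel\<close> and at \<open>PTarget\<close> by
  naturality of \<open>s\<close>.\<close>

lemma equalizer_colim_rel:
  assumes inj: "inj_on (canonical_map parallel_pair C F) (Colim C (lim_functor parallel_pair C F))"
    and x: "x \<in> FObj (equalizer X s t) j" and y: "y \<in> FObj (equalizer X s t) k"
    and rel: "((j, x), (k, y)) \<in> colim_rel C X"
  shows "((j, x), (k, y)) \<in> colim_rel C (equalizer X s t)"
proof -
  let ?L = "lim_functor parallel_pair C F"
  let ?x = "case_pp_obj x (s j x)" and ?y = "case_pp_obj y (s k y)"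
  note j = colim_rel_mem(1)[OF rel] and k = colim_rel_mem(2)[OF rel]
  have mem: "?x \<in> FObj ?L j" "?y \<in> FObj ?L k"
    using x y j k by (simp_all add: lim_functor_iff)
  have relY: "((j, s j x), (k, s k y)) \<in> colim_rel C Y"
    by (rule colim_rel_natural[OF natural_s X.category_axioms rel])
  have "colim_rel C X `` {(j, x)} = colim_rel C X `` {(k, y)}"
    "colim_rel C Y `` {(j, s j x)} = colim_rel C Y `` {(k, s k y)}"
    using colim_rel_class_eq colim_rel_mem rel relY by metis+
  then have "canonical_map parallel_pair C F (colim_rel C ?L `` {(j, ?x)})
      = canonical_map parallel_pair C F (colim_rel C ?L `` {(k, ?y)})"
    using mem canonical_map_class[OF category_parallel_pair X.category_axioms set_functor_pair j, of ?x]
      canonical_map_class[OF category_parallel_pair X.category_axioms set_functor_pair k, of ?y]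
    by (simp add: lim_functor_def)
      (auto intro!: restrict_ext simp: fix_fst_pair_functor split: pp_obj.splits)
  then have "colim_rel C ?L `` {(j, ?x)} = colim_rel C ?L `` {(k, ?y)}"
    by (rule inj_onD[OF inj]) (use mem j k in \<open>auto simp: Colim_def intro!: quotientI\<close>)
  then have "((j, ?x), (k, ?y)) \<in> colim_rel C ?L"
    using colim_rel_class_eq[OF j mem(1) k mem(2)] by simp
  from colim_rel_natural[OF natural_eval X.category_axioms this] show ?thesis by simp
qed

end


section \<open>Representable functors glued along a cosieve\<close>

text \<open>Commutation is available only for functors with values in \<open>'u\<close>, so arrows
  have to be encoded there. The boolean tag leaves room for two copies of every arrow, as gluing two
  representables requires.\<close>

locale commuting_cat =
  category J for J :: "('o, 'a) cat" (structure) +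
  fixes e :: "'a \<times> bool \<Rightarrow> 'u"
  assumes inj_e: "inj_on e (Arr J \<times> UNIV)"
    and commute: "colimits_commute_with_equalizers TYPE('u) J"
begin

definition decode :: "'u \<Rightarrow> 'a \<times> bool" where
  "decode = inv_into (Arr J \<times> UNIV) e"

lemma decode_e: "h \<in> Arr J \<Longrightarrow> decode (e (h, p)) = (h, p)"
  unfolding decode_def using inj_e by (intro inv_into_f_f) auto

text \<open>Only the arrows of \<open>S\<close> with domain \<open>a\<close> are constrained; they
  form a subfunctor of Hom(a, -).\<close>

definition cosieve :: "'o \<Rightarrow> 'a set \<Rightarrow> bool" where
  "cosieve a S \<longleftrightarrow> (\<forall>b c. \<forall>h\<in>Hom J a b. \<forall>g\<in>Hom J b c. h \<in> S \<longrightarrow> g \<cdot> h \<in> S)"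

text \<open>Two copies of \<open>Hom(a, -)\<close> glued along \<open>S\<close>, with elements encoded in \<open>'u\<close>; only the label
  \<open>True\<close> is kept on \<open>S\<close>. In particular \<open>glued a UNIV\<close> is the representable functor \<open>Hom(a, -)\<close>.\<close>

definition glued :: "'o \<Rightarrow> 'a set \<Rightarrow> ('o, 'a, 'u) sfun" where
  "glued a S =
    \<lparr>FObj = (\<lambda>b. e ` {(h, p). h \<in> Hom J a b \<and> (h \<in> S \<longrightarrow> p)}),
     FArr = (\<lambda>g u. case decode u of (h, p) \<Rightarrow> e (g \<cdot> h, p \<or> g \<cdot> h \<in> S))\<rparr>"

lemma Hom_Arr: "h \<in> Hom J a b \<Longrightarrow> h \<in> Arr J"
  by (simp add: Hom_def)

lemma glued_obj: "e (h, p) \<in> FObj (glued a S) b" if "h \<in> Hom J a b" "h \<in> S \<Longrightarrow> p"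
  using that by (auto simp: glued_def)

lemma glued_cases:
  assumes "u \<in> FObj (glued a S) b"
  obtains h p where "u = e (h, p)" "h \<in> Hom J a b" "h \<in> S \<Longrightarrow> p"
  using assms by (auto simp: glued_def)

lemma glued_arr: "h \<in> Hom J a b \<Longrightarrow> FArr (glued a S) g (e (h, p)) = e (g \<cdot> h, p \<or> g \<cdot> h \<in> S)"
  by (simp add: glued_def decode_e Hom_Arr)

lemma set_functor_glued:
  assumes "cosieve a S"
  shows "set_functor J (glued a S)"
proof unfold_locales
  fix f assume "f \<in> Arr J"
  then have f: "f \<in> Hom J (Dom J f) (Cod J f)" by (simp add: Hom_def)
  show "FArr (glued a S) f \<in> FObj (glued a S) (Dom J f) \<rightarrow> FObj (glued a S) (Cod J f)"
  proof
    fix u assume "u \<in> FObj (glued a S) (Dom J f)"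
    then show "FArr (glued a S) f u \<in> FObj (glued a S) (Cod J f)"
      by (cases rule: glued_cases) (auto simp: glued_arr intro!: glued_obj Cmp_Hom[OF _ f])
  qed
next
  fix b u assume "u \<in> FObj (glued a S) b"
  then show "FArr (glued a S) (Idn J b) u = u"
    by (cases rule: glued_cases) (auto simp: glued_arr Idn_Cmp intro!: arg_cong[of _ _ e])
next
  fix f b c g d u
  assume f: "f \<in> Hom J b c" and g: "g \<in> Hom J c d" and "u \<in> FObj (glued a S) b"
  from this(3) show "FArr (glued a S) (g \<cdot> f) u = FArr (glued a S) g (FArr (glued a S) f u)"
  proof (cases rule: glued_cases)
    case (1 h p)
    have fh: "f \<cdot> h \<in> Hom J a c" using Cmp_Hom 1(2) f .
    \<comment> \<open>Acting in two stages also sets the label when the intermediate arrow lies in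
      \<open>S\<close>; closure of \<open>S\<close> makes this agree with acting by the
      composite.\<close>
    have "f \<cdot> h \<in> S \<Longrightarrow> g \<cdot> (f \<cdot> h) \<in> S"
      using assms fh g by (auto simp: cosieve_def)
    then show ?thesis
      using 1 glued_arr[OF fh] by (auto simp: glued_arr Cmp_assoc[OF 1(2) f g] intro!: arg_cong[of _ _ e])
  qed
qed

abbreviation rep :: "'o \<Rightarrow> ('o, 'a, 'u) sfun" where
  "rep a \<equiv> glued a UNIV"

lemma set_functor_rep: "set_functor J (rep a)"
  by (rule set_functor_glued) (simp add: cosieve_def)

lemma rep_obj: "h \<in> Hom J a b \<Longrightarrow> e (h, True) \<in> FObj (rep a) b"
  by (rule glued_obj) simp_all

lemma rep_cases:
  assumes "u \<in> FObj (rep a) b"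
  obtains h where "u = e (h, True)" "h \<in> Hom J a b"
  using assms by (auto elim: glued_cases)

text \<open>As in the Yoneda lemma, an arrow \<open>h\<close> out of \<open>a\<close> is the image
  of the identity of \<open>a\<close> under the action of \<open>h\<close> itself, so every element
  is one step away from that identity.\<close>

lemma rep_connected:
  assumes "u \<in> FObj (rep a) b" and "v \<in> FObj (rep a) c"
  shows "((b, u), (c, v)) \<in> colim_rel J (rep a)"
proof -
  have from_Idn: "((a, e (Idn J a, True)), (b, u)) \<in> colim_rel J (rep a)"
    if u: "u \<in> FObj (rep a) b" for b u
  proof -
    obtain h where h: "u = e (h, True)" "h \<in> Hom J a b"
      using u by (rule rep_cases)
    have Idn: "Idn J a \<in> Hom J a a"
      using h(2) Dom_closed Idn_Hom by (auto simp: Hom_def)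
    show ?thesis
      using colim_rel_arr[OF set_functor_rep h(2) rep_obj[OF Idn]]
      by (simp add: glued_arr[OF Idn] Cmp_Idn[OF h(2)] h(1))
  qed
  show ?thesis
    using colim_rel_trans[OF colim_rel_sym[OF from_Idn] from_Idn] assms .
qed

lemma natural_pair_bij:
  assumes "natural_pair J X Y s (t :: 'o \<Rightarrow> 'u \<Rightarrow> 'u)"
  shows "bij_betw (canonical_map parallel_pair J (pair_functor J X Y s t))
    (Colim J (lim_functor parallel_pair J (pair_functor J X Y s t)))
    (Lim parallel_pair (colim_functor parallel_pair J (pair_functor J X Y s t)))"
  using commute natural_pair.set_functor_pair[OF assms]
  unfolding colimits_commute_with_equalizers_def limits_commute_with_colimits_def by blast

section \<open>Completing parallel pairs, spans and zigzags\<close>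

lemma coequalizing_arrow:
  assumes f: "f \<in> Hom J a b" and g: "g \<in> Hom J a b"
  obtains c h where "h \<in> Hom J b c" "h \<cdot> f = h \<cdot> g"
proof -
  \<comment> \<open>Precomposition with \<open>k\<close>, read through the encoding;
    \<open>True\<close> is the only label in a representable.\<close>
  define pre where "pre k = (\<lambda>_::'o. \<lambda>u. e (fst (decode u) \<cdot> k, True))" for k
  have pre: "pre k x (e (h, True)) = e (h \<cdot> k, True)" if "h \<in> Arr J" for k x h
    using that by (simp add: pre_def decode_e)
  have natural: "natural J (rep b) (rep a) (pre k)" if k: "k \<in> Hom J a b" for k
    unfolding natural_def
  proof (intro conjI ballI funcsetI)
    fix c u assume "u \<in> FObj (rep b) c"
    then show "pre k c u \<in> FObj (rep a) c"
      by (cases rule: rep_cases) (auto simp: pre Hom_Arr intro: rep_obj Cmp_Hom[OF k])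
  next
    fix m u assume m: "m \<in> Arr J" and "u \<in> FObj (rep b) (Dom J m)"
    from this(2) show "pre k (Cod J m) (FArr (rep b) m u) = FArr (rep a) m (pre k (Dom J m) u)"
    proof (cases rule: rep_cases)
      case (1 h)
      have m': "m \<in> Hom J (Dom J m) (Cod J m)" using m by (simp add: Hom_def)
      show ?thesis
        using 1 Hom_Arr[OF Cmp_Hom[OF 1(2) m']] Cmp_assoc[OF k 1(2) m'] Cmp_Hom[OF k 1(2)]
        by (simp add: glued_arr[of h b "Dom J m"] glued_arr[of "h \<cdot> k" a "Dom J m"] pre Hom_Arr)
    qed
  qed
  interpret natural_pair J "rep b" "rep a" "pre f" "pre g"
    by (intro natural_pair.intro natural_pair_axioms.intro set_functor_rep natural f g)
  have b: "b \<in> Obj J" and Idn: "Idn J b \<in> Hom J b b"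
    using f Cod_closed Idn_Hom by (auto simp: Hom_def)
  \<comment> \<open>At the identity of \<open>b\<close> the two transformations take the values
    \<open>f\<close> and \<open>g\<close>, which become equal in the one-point colimit of
    \<open>rep a\<close>. Surjectivity then makes the equalizer nonempty somewhere.\<close>
  have "pre f b (e (Idn J b, True)) \<in> FObj (rep a) b" "pre g b (e (Idn J b, True)) \<in> FObj (rep a) b"
    using natural[OF f] natural[OF g] b rep_obj[OF Idn] by (auto simp: natural_def)
  from rep_connected[OF this]
  obtain c u where "u \<in> FObj (equalizer (rep b) (pre f) (pre g)) c"
    using coequalized_has_equalizer[OF bij_betw_imp_surj_on[OF natural_pair_bij[OF natural_pair_axioms]]
        b rep_obj[OF Idn]] by blast
  then have u: "u \<in> FObj (rep b) c" "pre f c u = pre g c u"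
    by (simp_all add: equalizer_def)
  obtain h where h: "u = e (h, True)" "h \<in> Hom J b c"
    using u(1) by (rule rep_cases)
  have "e (h \<cdot> f, True) = e (h \<cdot> g, True)"
    using u(2) h by (simp add: pre Hom_Arr)
  then have "h \<cdot> f = h \<cdot> g"
    using inj_onD[OF inj_e] Hom_Arr[OF Cmp_Hom[OF f h(2)]] Hom_Arr[OF Cmp_Hom[OF g h(2)]] by blast
  with h(2) show thesis by (rule that)
qed

lemma ore_square:
  assumes f: "f \<in> Hom J a b" and g: "g \<in> Hom J a c"
  shows "\<exists>d. \<exists>h\<in>Hom J b d. \<exists>k\<in>Hom J c d. h \<cdot> f = k \<cdot> g"
proof (rule ccontr)
  assume no_square: "\<not> ?thesis"
  define Sf where "Sf = {k \<cdot> f | k d. k \<in> Hom J b d}"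
  define Sg where "Sg = {k \<cdot> g | k d. k \<in> Hom J c d}"
  define S where "S = Sf \<union> Sg"
  have factor: "m \<cdot> h \<in> {k \<cdot> p | k d. k \<in> Hom J z d}"
    if h: "h \<in> {k \<cdot> p | k d. k \<in> Hom J z d}" "h \<in> Hom J a x" and m: "m \<in> Hom J x y"
      and p: "p \<in> Hom J a z" for h x m y p z
  proof -
    obtain k d where k: "h = k \<cdot> p" "k \<in> Hom J z d" using h(1) by auto
    \<comment> \<open>An arrow determines its codomain, so the existentially bound object in
      \<open>Sf\<close> and \<open>Sg\<close> is the codomain of the arrow itself.\<close>
    have "d = x" using h(2) Cmp_Hom[OF p k(2)] k(1) by (simp add: Hom_def)
    with k(2) have kx: "k \<in> Hom J z x" by simp
    have "m \<cdot> h = (m \<cdot> k) \<cdot> p" using Cmp_assoc[OF p kx m] k(1) by simp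
    then show ?thesis using Cmp_Hom[OF kx m] by blast
  qed
  have Sf: "m \<cdot> h \<in> Sf" if "h \<in> Sf" "h \<in> Hom J a x" "m \<in> Hom J x y" for h x m y
    using factor[OF _ that(2,3) f] that(1) unfolding Sf_def by blast
  have Sg: "m \<cdot> h \<in> Sg" if "h \<in> Sg" "h \<in> Hom J a x" "m \<in> Hom J x y" for h x m y
    using factor[OF _ that(2,3) g] that(1) unfolding Sg_def by blast
  have disjoint: "Sf \<inter> Sg = {}"
  proof -
    have False if "k \<cdot> f = l \<cdot> g" "k \<in> Hom J b d" "l \<in> Hom J c d'" for k l d d'
    proof -
      have "d = d'" using Cmp_Hom[OF f that(2)] Cmp_Hom[OF g that(3)] that(1) by (simp add: Hom_def)
      then show False using that no_square by blast
    qed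
    then show ?thesis by (auto simp: Sf_def Sg_def)
  qed
  have mem: "f \<in> Sf" "g \<in> Sg"
    using f g Idn_Cmp[OF f] Idn_Cmp[OF g] Idn_Hom Cod_closed
    by (force simp: Sf_def Sg_def Hom_def)+
  have S: "cosieve a S"
    using Sf Sg by (auto simp: cosieve_def S_def)
  \<comment> \<open>The inclusion of Hom(a, -) as the second copy, labelled \<open>False\<close>
    exactly off \<open>S\<close>. The first copy has the label \<open>True\<close> throughout, so
    its inclusion is the identity on codes.\<close>
  define t where "t = (\<lambda>_::'o. \<lambda>u. e (fst (decode u), fst (decode u) \<in> S))"
  have t: "t x (e (h, True)) = e (h, h \<in> S)" if "h \<in> Arr J" for x h
    using that by (simp add: t_def decode_e)
  have natural_incl: "natural J (rep a) (glued a S) (\<lambda>_ u. u)"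
    by (auto simp: natural_def glued_arr elim!: rep_cases intro: glued_obj)
  have natural_t: "natural J (rep a) (glued a S) t"
    unfolding natural_def
  proof (intro conjI ballI funcsetI)
    fix x u assume "u \<in> FObj (rep a) x"
    then show "t x u \<in> FObj (glued a S) x"
      by (cases rule: rep_cases) (auto simp: t Hom_Arr intro: glued_obj)
  next
    fix m u assume m: "m \<in> Arr J" and "u \<in> FObj (rep a) (Dom J m)"
    from this(2) show "t (Cod J m) (FArr (rep a) m u) = FArr (glued a S) m (t (Dom J m) u)"
    proof (cases rule: rep_cases)
      case (1 h)
      have m': "m \<in> Hom J (Dom J m) (Cod J m)" using m by (simp add: Hom_def)
      have "h \<in> S \<Longrightarrow> m \<cdot> h \<in> S" using S 1(2) m' by (auto simp: cosieve_def)
      then show ?thesis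
        using 1 Hom_Arr[OF Cmp_Hom[OF 1(2) m']] by (auto simp: glued_arr t Hom_Arr intro!: arg_cong[of _ _ e])
    qed
  qed
  interpret natural_pair J "rep a" "glued a S" "\<lambda>_ u. u" t
    by (intro natural_pair.intro natural_pair_axioms.intro set_functor_rep set_functor_glued S
      natural_incl natural_t)
  let ?E = "equalizer (rep a) (\<lambda>_ u. u) t"
  \<comment> \<open>By injectivity of \<open>e\<close>, the two inclusions agree precisely where the
    labels do, so the equalizer is the subfunctor given by \<open>S\<close>.\<close>
  have E_iff: "e (h, True) \<in> FObj ?E x \<longleftrightarrow> h \<in> S" if h: "h \<in> Hom J a x" for h x
    using rep_obj[OF h] inj_onD[OF inj_e, of "(h, True)" "(h, h \<in> S)"] Hom_Arr[OF h]
    by (auto simp: equalizer_def t)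
  have rel: "((b, e (f, True)), (c, e (g, True))) \<in> colim_rel J ?E"
    using equalizer_colim_rel[OF bij_betw_imp_inj_on[OF natural_pair_bij[OF natural_pair_axioms]]]
      E_iff[OF f] E_iff[OF g] mem rep_connected[OF rep_obj[OF f] rep_obj[OF g]]
    by (simp add: S_def)
  \<comment> \<open>Within \<open>S\<close>, the complement of \<open>Sf\<close> is
    \<open>Sg\<close>, and both are closed under postcomposition. Membership in \<open>Sf\<close> is
    therefore invariant, yet it separates \<open>f\<close> from \<open>g\<close>.\<close>
  have "fst (decode (e (f, True))) \<in> Sf \<longleftrightarrow> fst (decode (e (g, True))) \<in> Sf"
  proof (rule colim_rel_invariant[OF rel])
    fix m u assume m: "m \<in> Arr J" and u: "u \<in> FObj ?E (Dom J m)"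
    then have "u \<in> FObj (rep a) (Dom J m)" by (simp add: equalizer_def)
    then obtain h where h: "u = e (h, True)" "h \<in> Hom J a (Dom J m)" by (rule rep_cases)
    have m': "m \<in> Hom J (Dom J m) (Cod J m)" using m by (simp add: Hom_def)
    have "h \<in> Sf \<or> h \<in> Sg" using u h E_iff by (simp add: S_def)
    then have "m \<cdot> h \<in> Sf \<longleftrightarrow> h \<in> Sf"
      using Sf[OF _ h(2) m'] Sg[OF _ h(2) m'] disjoint by blast
    then show "fst (decode (FArr ?E m u)) \<in> Sf \<longleftrightarrow> fst (decode u) \<in> Sf"
      using h Hom_Arr[OF Cmp_Hom[OF h(2) m']]
      by (simp add: equalizer_def glued_arr decode_e Hom_Arr)
  qed
  then show False
    using mem disjoint f g by (auto simp: decode_e Hom_Arr)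
qed

lemma upper_bound_if_connected:
  assumes "(a, b) \<in> connected_rel J"
  obtains c where "Hom J a c \<noteq> {}" "Hom J b c \<noteq> {}"
proof -
  have a: "a \<in> Obj J" and "(a, b) \<in> (arrow_rel J \<union> (arrow_rel J)\<inverse>)\<^sup>*"
    using assms by (auto simp: connected_rel_def)
  from this(2) have "\<exists>c. Hom J a c \<noteq> {} \<and> Hom J b c \<noteq> {}"
  proof induction
    case base
    show ?case using Idn_Hom[OF a] by blast
  next
    case (step b b')
    obtain c f g where f: "f \<in> Hom J a c" and g: "g \<in> Hom J b c" using step.IH by blast
    \<comment> \<open>A forward arrow of the zigzag forms a span with \<open>g\<close>, to be
      completed to a square; a backward arrow is simply composed with \<open>g\<close>.\<close>
    from step.hyps(2) consider m where "m \<in> Hom J b b'" | m where "m \<in> Hom J b' b"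
      by (auto simp: arrow_rel_def Hom_def)
    then show ?case
    proof cases
      case 1
      obtain d h k where "h \<in> Hom J c d" "k \<in> Hom J b' d" using ore_square[OF g 1] by blast
      then show ?thesis using Cmp_Hom[OF f] by blast
    next
      case 2
      then show ?thesis using f Cmp_Hom[OF 2 g] by blast
    qed
  qed
  then show thesis using that by blast
qed

end

section \<open>Connected components and the conclusion\<close>

lemma equiv_connected_rel: "equiv (Obj C) (connected_rel C)"
proof (rule equivI)
  have "sym ((arrow_rel C \<union> (arrow_rel C)\<inverse>)\<^sup>*)"
    by (intro sym_rtrancl sym_Un_converse)
  then show "sym (connected_rel C)"
    unfolding connected_rel_def by (auto simp: sym_def)
  show "trans (connected_rel C)"
    unfolding connected_rel_def trans_def by (auto intro: rtrancl_trans)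
qed (auto simp: connected_rel_def refl_on_def)

lemma (in category) Hom_connected: "f \<in> Hom C a b \<Longrightarrow> (a, b) \<in> connected_rel C"
  using Dom_closed Cod_closed by (auto simp: Hom_def connected_rel_def arrow_rel_def)

lemma (in commuting_cat) pseudo_filtered: "pseudo_filtered J"
  unfolding pseudo_filtered_def connected_components_def
proof safe
  fix K assume K: "K \<in> Obj J // connected_rel J"
  note eq = equiv_connected_rel[of J]
  have Hom: "Hom (full_subcat J K) a b = Hom J a b" if "a \<in> K" "b \<in> K" for a b
    using that by (auto simp: Hom_def full_subcat_def)
  \<comment> \<open>A component contains the target of every arrow that starts in it, so the cocones
    found in \<open>J\<close> already lie in the component.\<close>
  have closed: "b \<in> K" if "a \<in> K" "f \<in> Hom J a b" for a b f
    using in_quotient_imp_closed[OF eq K that(1) Hom_connected[OF that(2)]] .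
  have sub: "Obj (full_subcat J K) = K" "Cmp (full_subcat J K) = Cmp J"
    by (simp_all add: full_subcat_def)
  show "filtered (full_subcat J K)"
    unfolding filtered_def sub
  proof (intro conjI ballI)
    show "K \<noteq> {}" using in_quotient_imp_non_empty[OF eq K] .
  next
    fix a b assume ab: "a \<in> K" "b \<in> K"
    then have "(a, b) \<in> connected_rel J" using in_quotient_imp_in_rel[OF eq K] by simp
    then obtain c where "Hom J a c \<noteq> {}" "Hom J b c \<noteq> {}" by (rule upper_bound_if_connected)
    then show "\<exists>c\<in>K. Hom (full_subcat J K) a c \<noteq> {} \<and> Hom (full_subcat J K) b c \<noteq> {}"
      using ab closed Hom by (metis ex_in_conv)
  next
    fix a b f g
    assume ab: "a \<in> K" "b \<in> K" and "f \<in> Hom (full_subcat J K) a b" "g \<in> Hom (full_subcat J K) a b"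
    then obtain c h where "h \<in> Hom J b c" "h \<cdot> f = h \<cdot> g"
      using coequalizing_arrow by (metis Hom)
    then show "\<exists>c\<in>K. \<exists>h\<in>Hom (full_subcat J K) b c. h \<cdot> f = h \<cdot> g"
      using ab closed Hom by metis
  qed
qed

text \<open>An infinite cardinal absorbs doubling; the product with \<open>bool\<close> is read as a
  sum of two copies.\<close>

lemma inj_times_bool_if_infinite:
  assumes "infinite (UNIV :: 'u set)"
  shows "\<exists>r :: 'u \<times> bool \<Rightarrow> 'u. inj r"
proof -
  obtain r :: "'u + 'u \<Rightarrow> 'u" where "bij r"
    using card_of_Plus_infinite1[OF assms card_of_mono1[OF subset_refl]]
    unfolding card_of_ordIso[symmetric] UNIV_Plus_UNIV by blast
  then have "inj (\<lambda>(x, p). r (if p then Inl x else Inr x))"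
    by (auto simp: inj_on_def bij_def split: if_splits)
  then show ?thesis by blast
qed

theorem corollary2p3:
  fixes J :: "('o, 'a) cat"
  assumes "small_cat TYPE('u) J"
    and "colimits_commute_with_equalizers TYPE('u) J"
  shows "pseudo_filtered J"
proof -
  obtain \<iota> :: "'a \<Rightarrow> 'u" where J: "category J" and \<iota>: "inj_on \<iota> (Arr J)"
    and inf: "infinite (UNIV :: 'u set)"
    using assms(1) by (auto simp: small_cat_def)
  obtain r :: "'u \<times> bool \<Rightarrow> 'u" where "inj r"
    using inj_times_bool_if_infinite[OF inf] ..
  \<comment> \<open>This supplies the encoding \<open>e\<close>: embed the arrows by
    \<open>\<iota>\<close>, then make room for the tag by \<open>r\<close>.\<close>
  then have "inj_on (\<lambda>(h, p). r (\<iota> h, p)) (Arr J \<times> UNIV)"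
    using \<iota> by (auto simp: inj_on_def)
  with J assms(2) show ?thesis
    by (intro commuting_cat.pseudo_filtered commuting_cat.intro commuting_cat_axioms.intro)
qed

end
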